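(* Let $\{\Phi_n\}_{n=1}^\infty$, $\Phi_n=\{\phi_{n,j}\}_{j=1}^{N_n}$, be a Moran-type iterated function system (MIFS) on $(X,\rho)$, where $X\subset\mathbb{R}^d$. (i) For every $n\ge 1$ the set $$K_n:=\Big\{\lim_{k\to+\infty}\phi_{n,j_n}\circ\phi_{n+1,j_{n+1}}\circ\cdots\circ\phi_{n+k,j_{n+k}}(a):\ 1\le j_{n+k}\le N_{n+k},\ k\ge 0\Big\}$$ is a well-defined compact subset of $X$ (in particular all these limits exist) and is independent of $a\in X$. Moreover, $\{K_n\}_{n=1}^\infty$ is the unique sequence of nonempty compact subsets of $X$ such that $$K_n=\bigcup_{j=1}^{N_n}\phi_{n,j}(K_{n+1})\qquad\text{for all } n\ge 1.$$ (ii) For any given sequence of probability weights $\mathcal{P}_n=\{p_{n,1},\dots,p_{n,N_n}\}$ (i.e. $p_{n,j}>0$ and $\sum_{j=1}^{N_n}p_{n,j}=1$ for all $n\ge 1$, $1\le j\le N_n$), there exists a unique sequence of Borel probability measures $\{\mu_n\}_{n=1}^\infty$, with $\mu_n$ supported on $K_n$ for each $n$, such that $$\mu_n=\sum_{j=1}^{N_n}p_{n,j}\,\mu_{n+1}\circ\phi_{n,j}^{-1}\qquad\text{for all } n\ge 1.$$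
   Context: Definition (MIFS). Let $X\subset\mathbb{R}^d$ be a nonempty compact set and, for each $n\ge1$, let $\Phi_n=\{\phi_{n,j}\}_{j=1}^{N_n}$ with $2\le N_n<+\infty$ be a collection of bi-Lipschitz maps from $X$ to itself. Suppose there exist constants $0<c_{1,n}\le c_{2,n}<1$ $(n\ge1)$ and a metric $\rho$ on $\mathbb{R}^d$ such that $\phi_{n,j}(X)\subseteq X$, $\lim_{n\to+\infty}\prod_{j=1}^n c_{2,j}=0$, and $$c_{1,n}\rho(x,y)\le\rho(\phi_{n,j}(x),\phi_{n,j}(y))\le c_{2,n}\rho(x,y)\quad\text{for all }x,y\in X,$$ whenever $1\le j\le N_n$ and $n\ge1$. Then $\{\Phi_n\}_{n=1}^\infty$ is called a Moran-type iterated function system (MIFS) on $(X,\rho)$. Here $(X,\rho)$ is a compact metric space, and limits and compactness are taken in $(X,\rho)$. For a measure $\mu$ and a map $\phi$, $\mu\circ\phi^{-1}$ is the push-forward measure $E\mapsto\mu(\phi^{-1}(E))$. *)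

theory Defs
  imports "HOL-Probability.Probability"
begin

text \<open>
  The metric \<open>\<rho>\<close> is an arbitrary metric on $\mathbb{R}^d$; it need not induce the Euclidean
  topology. Hence limits, compactness and Borel sets all refer to the metric space $(X,\rho)$,
  that is to \<open>Metric_space.mtopology X \<rho>\<close>, and not to the type class topology of
  \<^typ>\<open>real ^ 'd\<close>. All sequences are indexed by \<open>n \<ge> 1\<close>; values at index 0 are irrelevant.
\<close>

text \<open>
  Each \<open>\<phi> n j\<close> is a function on the whole of $\mathbb{R}^d$, of which only the restriction to
  \<open>X\<close> is used. The two-sided estimate with \<open>0 < c1 n\<close> says in particular that this restriction
  is bi-Lipschitz with respect to \<open>\<rho>\<close>.
\<close>

definition MIFS ::
  "(real ^ 'd) set \<Rightarrow> (real ^ 'd \<Rightarrow> real ^ 'd \<Rightarrow> real) \<Rightarrow> (nat \<Rightarrow> nat)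
    \<Rightarrow> (nat \<Rightarrow> nat \<Rightarrow> real ^ 'd \<Rightarrow> real ^ 'd) \<Rightarrow> bool" where
  "MIFS X \<rho> N \<phi> \<longleftrightarrow>
     X \<noteq> {} \<and> Metric_space UNIV \<rho> \<and> compact_space (Metric_space.mtopology X \<rho>) \<and>
     (\<forall>n\<ge>1. 2 \<le> N n) \<and>
     (\<forall>n\<ge>1. \<forall>j\<in>{1..N n}. \<phi> n j ` X \<subseteq> X) \<and>
     (\<exists>c1 c2 :: nat \<Rightarrow> real.
        (\<forall>n\<ge>1. 0 < c1 n \<and> c1 n \<le> c2 n \<and> c2 n < 1) \<and>
        (\<lambda>n. \<Prod>j=1..n. c2 j) \<longlonglongrightarrow> 0 \<and>
        (\<forall>n\<ge>1. \<forall>j\<in>{1..N n}. \<forall>x\<in>X. \<forall>y\<in>X.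
           c1 n * \<rho> x y \<le> \<rho> (\<phi> n j x) (\<phi> n j y) \<and>
           \<rho> (\<phi> n j x) (\<phi> n j y) \<le> c2 n * \<rho> x y))"

definition codes :: "(nat \<Rightarrow> nat) \<Rightarrow> nat \<Rightarrow> (nat \<Rightarrow> nat) set" where
  "codes N n = {j. \<forall>m\<ge>n. j m \<in> {1..N m}}"

text \<open>
  \<open>comp_maps \<phi> j n k\<close> is
  $\phi_{n,j_n}\circ\phi_{n+1,j_{n+1}}\circ\cdots\circ\phi_{n+k,j_{n+k}}$ ($k+1$ factors).
\<close>

primrec comp_maps :: "(nat \<Rightarrow> nat \<Rightarrow> 'a \<Rightarrow> 'a) \<Rightarrow> (nat \<Rightarrow> nat) \<Rightarrow> nat \<Rightarrow> nat \<Rightarrow> 'a \<Rightarrow> 'a" where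
  "comp_maps \<phi> j n 0 = \<phi> n (j n)"
| "comp_maps \<phi> j n (Suc k) = comp_maps \<phi> j n k \<circ> \<phi> (n + Suc k) (j (n + Suc k))"

definition limit_set ::
  "'a set \<Rightarrow> ('a \<Rightarrow> 'a \<Rightarrow> real) \<Rightarrow> (nat \<Rightarrow> nat) \<Rightarrow> (nat \<Rightarrow> nat \<Rightarrow> 'a \<Rightarrow> 'a) \<Rightarrow> 'a \<Rightarrow> nat \<Rightarrow> 'a set" where
  "limit_set X \<rho> N \<phi> a n =
     {l. \<exists>j\<in>codes N n.
           limitin (Metric_space.mtopology X \<rho>) (\<lambda>k. comp_maps \<phi> j n k a) l sequentially}"

definition invariant_sets ::
  "'a set \<Rightarrow> ('a \<Rightarrow> 'a \<Rightarrow> real) \<Rightarrow> (nat \<Rightarrow> nat) \<Rightarrow> (nat \<Rightarrow> nat \<Rightarrow> 'a \<Rightarrow> 'a) \<Rightarrow> (nat \<Rightarrow> 'a set) \<Rightarrow> bool" where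
  "invariant_sets X \<rho> N \<phi> K \<longleftrightarrow>
     (\<forall>n\<ge>1. K n \<noteq> {} \<and> compactin (Metric_space.mtopology X \<rho>) (K n) \<and>
            K n = (\<Union>j\<in>{1..N n}. \<phi> n j ` K (n + 1)))"

definition metric_borel :: "'a set \<Rightarrow> ('a \<Rightarrow> 'a \<Rightarrow> real) \<Rightarrow> 'a measure" where
  "metric_borel X \<rho> = sigma X {U. openin (Metric_space.mtopology X \<rho>) U}"

definition probability_weights :: "(nat \<Rightarrow> nat) \<Rightarrow> (nat \<Rightarrow> nat \<Rightarrow> real) \<Rightarrow> bool" where
  "probability_weights N p \<longleftrightarrow>
     (\<forall>n\<ge>1. (\<forall>j\<in>{1..N n}. 0 < p n j) \<and> (\<Sum>j=1..N n. p n j) = 1)"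

text \<open>
  The push-forward \<open>\<mu> (n + 1) \<circ> (\<phi> n j)\<^sup>-\<^sup>1\<close> is \<^const>\<open>distr\<close>; the maps \<open>\<phi> n j\<close> of an MIFS are
  Borel measurable on \<open>X\<close>, being Lipschitz. A measure is supported on the closed set \<open>K n\<close> if
  the complement of \<open>K n\<close> is a null set.
\<close>

definition invariant_measures ::
  "'a set \<Rightarrow> ('a \<Rightarrow> 'a \<Rightarrow> real) \<Rightarrow> (nat \<Rightarrow> nat) \<Rightarrow> (nat \<Rightarrow> nat \<Rightarrow> 'a \<Rightarrow> 'a) \<Rightarrow> (nat \<Rightarrow> nat \<Rightarrow> real)
    \<Rightarrow> (nat \<Rightarrow> 'a set) \<Rightarrow> (nat \<Rightarrow> 'a measure) \<Rightarrow> bool" where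
  "invariant_measures X \<rho> N \<phi> p K \<mu> \<longleftrightarrow>
     (\<forall>n\<ge>1. prob_space (\<mu> n) \<and>
            space (\<mu> n) = X \<and> sets (\<mu> n) = sets (metric_borel X \<rho>) \<and>
            emeasure (\<mu> n) (X - K n) = 0 \<and>
            (\<forall>A\<in>sets (metric_borel X \<rho>).
               emeasure (\<mu> n) A =
               (\<Sum>j=1..N n. ennreal (p n j) *
                  emeasure (distr (\<mu> (n + 1)) (metric_borel X \<rho>) (\<phi> n j)) A)))"

end

theory Submission
  imports Defs
begin

text \<open>
  A composition of $k$ maps contracts $X$ to a set of diameter at most $c_n \cdots c_{n+k-1}$
  times that of $X$, uniformly in the code. So every code determines a point, $K_n$ is the image
  of the code space, and any sequence of sets with $L_n \subseteq \bigcup_j \phi_{n,j}(L_{n+1})$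
  satisfies $L_n \subseteq K_n$, since its points can be coded. Applied to the closures of the
  $K_n$ this shows that $K_n$ is compact.

  The measure $\mu_n$ is the image under the coding map of the infinite product of the
  probability weights. For two invariant sequences $\mu$ and $\nu$, the self-similarity gives
  $\nu_n(C) \le \mu_n(C_r)$ for the $r$-neighbourhoods of a set $C$ with arbitrarily small $r$,
  hence $\nu_n(C) \le \mu_n(C)$ for closed $C$, and equality by symmetry.
\<close>

section \<open>Compositions, codes and the Borel sets of a metric\<close>

lemma comp_maps_Suc_left:
  "comp_maps \<phi> j n (Suc k) x = \<phi> n (j n) (comp_maps \<phi> j (Suc n) k x)"
  by (induction k arbitrary: x) auto

lemma comp_maps_cong:
  "(\<And>m. m \<ge> n \<Longrightarrow> i m = j m) \<Longrightarrow> comp_maps \<phi> i n k = comp_maps \<phi> j n k"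
  by (induction k) auto

lemma codes_mono: "j \<in> codes N n \<Longrightarrow> n \<le> m \<Longrightarrow> j \<in> codes N m"
  by (auto simp: codes_def)

lemma sets_metric_borel:
  assumes "Metric_space X \<rho>"
  shows "sets (metric_borel X \<rho>) = sigma_sets X {U. openin (Metric_space.mtopology X \<rho>) U}"
    and "space (metric_borel X \<rho>) = X"
proof -
  interpret Metric_space X \<rho> by fact
  have *: "{U. openin mtopology U} \<subseteq> Pow X"
    using openin_subset by fastforce
  show "sets (metric_borel X \<rho>) = sigma_sets X {U. openin mtopology U}"
    unfolding metric_borel_def using * by (rule sets_measure_of)
  show "space (metric_borel X \<rho>) = X"
    unfolding metric_borel_def using * by (rule space_measure_of)
qed

section \<open>Contraction of compositions along a code\<close>

locale moran_system = Metric_space X \<rho>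
  for X :: "'a set" and \<rho> :: "'a \<Rightarrow> 'a \<Rightarrow> real" +
  fixes N :: "nat \<Rightarrow> nat" and \<phi> :: "nat \<Rightarrow> nat \<Rightarrow> 'a \<Rightarrow> 'a" and c :: "nat \<Rightarrow> real"
  assumes nonempty: "X \<noteq> {}"
    and compact: "compact_space mtopology"
    and N_pos: "n \<ge> 1 \<Longrightarrow> 1 \<le> N n"
    and maps: "n \<ge> 1 \<Longrightarrow> j \<in> {1..N n} \<Longrightarrow> x \<in> X \<Longrightarrow> \<phi> n j x \<in> X"
    and c_pos: "n \<ge> 1 \<Longrightarrow> 0 < c n"
    and prod_c: "(\<lambda>n. \<Prod>j=1..n. c j) \<longlonglongrightarrow> 0"
    and lipschitz: "n \<ge> 1 \<Longrightarrow> j \<in> {1..N n} \<Longrightarrow> x \<in> X \<Longrightarrow> y \<in> X \<Longrightarrow>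
                      \<rho> (\<phi> n j x) (\<phi> n j y) \<le> c n * \<rho> x y"
begin

lemma bounded_dist: obtains R where "R > 0" "\<And>x y. x \<in> X \<Longrightarrow> y \<in> X \<Longrightarrow> \<rho> x y < R"
proof -
  have "mbounded X"
    using compact by (auto intro: compactin_imp_mbounded simp: compact_space_def)
  then obtain B where "B > 0" "\<forall>x\<in>X. \<forall>y\<in>X. \<rho> x y \<le> B"
    unfolding mbounded_alt_pos by blast
  \<comment> \<open>Enlarging the bound to \<open>B + 1\<close> makes the inequality strict, so that
    an open ball of radius R about any point of X is all of X.\<close>
  then show thesis
    by (intro that[of "B + 1"]) force+
qed

text \<open>The products that start at 1 tend to 0, and dividing them by the fixed head over
  \<open>{1..<n}\<close>, positive by \<open>c_pos\<close>, leaves the products that start at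
  n.\<close>

lemma tail_prod_tendsto_0:
  assumes "n \<ge> 1"
  shows "(\<lambda>k. \<Prod>i\<in>{n..<n+k}. c i) \<longlonglongrightarrow> 0"
proof -
  have pos: "(\<Prod>i\<in>{1..<n}. c i) > 0"
    by (intro prod_pos) (auto simp: c_pos)
  have "(\<Prod>i\<in>{n..<n+k}. c i) = (\<Prod>i=1..n+k-1. c i) / (\<Prod>i\<in>{1..<n}. c i)" for k
  proof -
    have "{1..n+k-1} = {1..<n+k}"
      using assms by auto
    moreover have "(\<Prod>i\<in>{1..<n}. c i) * (\<Prod>i\<in>{n..<n+k}. c i) = (\<Prod>i\<in>{1..<n+k}. c i)"
      using assms by (intro prod.atLeastLessThan_concat) auto
    ultimately show ?thesis
      using pos by (metis less_irrefl nonzero_mult_div_cancel_left)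
  qed
  moreover have "(\<lambda>k. (\<Prod>i=1..n+k-1. c i) / (\<Prod>i\<in>{1..<n}. c i)) \<longlonglongrightarrow> 0 / (\<Prod>i\<in>{1..<n}. c i)"
  proof (intro tendsto_divide tendsto_const)
    have "(\<lambda>k. \<Prod>i=1..k+(n-1). c i) \<longlonglongrightarrow> 0"
      by (rule LIMSEQ_ignore_initial_segment[OF prod_c])
    moreover have "k + (n - 1) = n + k - 1" for k
      using assms by simp
    ultimately show "(\<lambda>k. \<Prod>i=1..n+k-1. c i) \<longlonglongrightarrow> 0"
      by simp
  qed (use pos in linarith)
  ultimately show ?thesis
    by simp
qed

lemma comp_maps_in:
  assumes "n \<ge> 1" "j \<in> codes N n" "x \<in> X"
  shows "comp_maps \<phi> j n k x \<in> X"
  using assms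
proof (induction k arbitrary: x)
  case (Suc k)
  then show ?case
    using maps[of "n + Suc k" "j (n + Suc k)" x] by (auto simp: codes_def)
qed (auto simp: codes_def intro: maps)

lemma comp_maps_lipschitz:
  assumes "n \<ge> 1" "j \<in> codes N n" "x \<in> X" "y \<in> X"
  shows "\<rho> (comp_maps \<phi> j n k x) (comp_maps \<phi> j n k y) \<le> (\<Prod>i\<in>{n..<n+Suc k}. c i) * \<rho> x y"
  using assms
proof (induction k arbitrary: x y)
  case 0
  then show ?case
    using lipschitz[of n "j n" x y] by (auto simp: codes_def)
next
  case (Suc k)
  let ?m = "n + Suc k"
  have jm: "j ?m \<in> {1..N ?m}" and m: "?m \<ge> 1"
    using Suc.prems by (auto simp: codes_def)
  have "\<rho> (comp_maps \<phi> j n (Suc k) x) (comp_maps \<phi> j n (Suc k) y)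
      \<le> (\<Prod>i\<in>{n..<?m}. c i) * \<rho> (\<phi> ?m (j ?m) x) (\<phi> ?m (j ?m) y)"
    using Suc.IH[of "\<phi> ?m (j ?m) x" "\<phi> ?m (j ?m) y"] Suc.prems maps[OF m jm] by simp
  also have "\<dots> \<le> (\<Prod>i\<in>{n..<?m}. c i) * (c ?m * \<rho> x y)"
    using lipschitz[OF m jm] Suc.prems c_pos
    by (intro mult_left_mono prod_nonneg) (auto intro: less_imp_le)
  finally show ?case
    by (simp add: mult.assoc)
qed

text \<open>The Lipschitz bound depends on the levels only and X is bounded, so one
  \<open>k0\<close> serves all codes and all pairs of points. This uniformity underlies convergence,
  independence of the base point and measurability of the coding map.\<close>

lemma comp_maps_uniformly_close:
  assumes "n \<ge> 1" "e > 0"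
  obtains k0 where "\<And>k j x y. k \<ge> k0 \<Longrightarrow> j \<in> codes N n \<Longrightarrow> x \<in> X \<Longrightarrow> y \<in> X \<Longrightarrow>
    \<rho> (comp_maps \<phi> j n k x) (comp_maps \<phi> j n k y) < e"
proof -
  obtain R where R: "R > 0" "\<And>x y. x \<in> X \<Longrightarrow> y \<in> X \<Longrightarrow> \<rho> x y < R"
    using bounded_dist by blast
  have "(\<lambda>k. (\<Prod>i\<in>{n..<n+Suc k}. c i) * R) \<longlonglongrightarrow> 0 * R"
    using LIMSEQ_Suc[OF tail_prod_tendsto_0[OF assms(1)]] by (intro tendsto_intros)
  then have "\<forall>\<^sub>F k in sequentially. (\<Prod>i\<in>{n..<n+Suc k}. c i) * R < e"
    using assms(2) by (intro order_tendstoD(2)[where y=0]) simp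
  then obtain k0 where k0: "\<And>k. k \<ge> k0 \<Longrightarrow> (\<Prod>i\<in>{n..<n+Suc k}. c i) * R < e"
    unfolding eventually_sequentially by blast
  show thesis
  proof (rule that)
    fix k j x y
    assume *: "k0 \<le> k" "j \<in> codes N n" "x \<in> X" "y \<in> X"
    have "(\<Prod>i\<in>{n..<n+Suc k}. c i) * \<rho> x y \<le> (\<Prod>i\<in>{n..<n+Suc k}. c i) * R"
      using R(2)[OF *(3,4)] assms c_pos
      by (intro mult_left_mono prod_nonneg) (auto intro: less_imp_le)
    then show "\<rho> (comp_maps \<phi> j n k x) (comp_maps \<phi> j n k y) < e"
      using comp_maps_lipschitz[OF assms(1) *(2-4), of k] k0[OF *(1)] by linarith
  qed
qed

text \<open>The innermost i factors map X into X and can be absorbed into the argument. Two long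
  compositions of one code are therefore values of the same shorter composition, which reduces the
  Cauchy property to \<open>comp_maps_uniformly_close\<close>.\<close>

lemma comp_maps_add:
  assumes "n \<ge> 1" "j \<in> codes N n" "x \<in> X"
  shows "\<exists>y\<in>X. comp_maps \<phi> j n (k + i) x = comp_maps \<phi> j n k y"
  using assms
proof (induction i arbitrary: x)
  case (Suc i)
  then show ?case
    using maps[of "n + Suc (k + i)" "j (n + Suc (k + i))" x] by (auto simp: codes_def)
qed auto

section \<open>Convergence of compositions and the coding map\<close>

lemma comp_maps_convergent:
  assumes "n \<ge> 1" "j \<in> codes N n" "a \<in> X"
  shows "\<exists>l. limitin mtopology (\<lambda>k. comp_maps \<phi> j n k a) l sequentially"
proof -
  have "MCauchy (\<lambda>k. comp_maps \<phi> j n k a)"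
    unfolding MCauchy_def
  proof (intro conjI allI impI)
    show "range (\<lambda>k. comp_maps \<phi> j n k a) \<subseteq> X"
      using comp_maps_in assms by auto
    fix e :: real assume "e > 0"
    then obtain k0 where k0: "\<And>k j x y. k \<ge> k0 \<Longrightarrow> j \<in> codes N n \<Longrightarrow> x \<in> X \<Longrightarrow> y \<in> X \<Longrightarrow>
        \<rho> (comp_maps \<phi> j n k x) (comp_maps \<phi> j n k y) < e"
      using comp_maps_uniformly_close assms(1) by blast
    show "\<exists>M. \<forall>k k'. M \<le> k \<longrightarrow> M \<le> k' \<longrightarrow> \<rho> (comp_maps \<phi> j n k a) (comp_maps \<phi> j n k' a) < e"
    proof (intro exI allI impI)
      fix k k' assume "k0 \<le> k" "k0 \<le> k'"
      then obtain i i' where "k = k0 + i" "k' = k0 + i'"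
        by (metis le_Suc_ex)
      then show "\<rho> (comp_maps \<phi> j n k a) (comp_maps \<phi> j n k' a) < e"
        using comp_maps_add[OF assms, of k0 i] comp_maps_add[OF assms, of k0 i'] k0 assms(2)
        by auto
    qed
  qed
  then show ?thesis
    using compact_space_imp_mcomplete[OF compact] unfolding mcomplete_def by blast
qed

text \<open>The base points may vary with k: besides independence of a fixed base point, this covers
  points that are selected anew at every level of a sequence of sets.\<close>

lemma comp_maps_limit_change_points:
  assumes "n \<ge> 1" "j \<in> codes N n" "\<And>k. x k \<in> X" "\<And>k. y k \<in> X"
    and lim: "limitin mtopology (\<lambda>k. comp_maps \<phi> j n k (x k)) l sequentially"
  shows "limitin mtopology (\<lambda>k. comp_maps \<phi> j n k (y k)) l sequentially"
  unfolding limit_metric_sequentially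
proof (intro conjI allI impI)
  show l: "l \<in> X"
    using lim by (rule limitin_mspace)
  fix e :: real assume e: "e > 0"
  then obtain k0 where k0: "\<And>k j x y. k \<ge> k0 \<Longrightarrow> j \<in> codes N n \<Longrightarrow> x \<in> X \<Longrightarrow> y \<in> X \<Longrightarrow>
      \<rho> (comp_maps \<phi> j n k x) (comp_maps \<phi> j n k y) < e/2"
    using comp_maps_uniformly_close[OF assms(1), of "e/2"] by auto
  obtain k1 where k1: "\<And>k. k \<ge> k1 \<Longrightarrow> \<rho> (comp_maps \<phi> j n k (x k)) l < e/2"
    using lim e unfolding limit_metric_sequentially by (meson half_gt_zero)
  show "\<exists>M. \<forall>k\<ge>M. comp_maps \<phi> j n k (y k) \<in> X \<and> \<rho> (comp_maps \<phi> j n k (y k)) l < e"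
  proof (intro exI allI impI conjI)
    fix k assume k: "max k0 k1 \<le> k"
    show "comp_maps \<phi> j n k (y k) \<in> X"
      using assms by (intro comp_maps_in)
    then show "\<rho> (comp_maps \<phi> j n k (y k)) l < e"
      using k0[of k j "y k" "x k"] k1[of k] k assms comp_maps_in[of n j "x k" k]
        triangle[of "comp_maps \<phi> j n k (y k)" "comp_maps \<phi> j n k (x k)" l] l
      by auto
  qed
qed

text \<open>The description asks for the limit at every base point at once, so no base point enters
  the notation; since X is nonempty, at most one point qualifies.\<close>

definition code_point :: "(nat \<Rightarrow> nat) \<Rightarrow> nat \<Rightarrow> 'a" where
  "code_point j n =
     (THE l. \<forall>a\<in>X. limitin mtopology (\<lambda>k. comp_maps \<phi> j n k a) l sequentially)"

lemma code_point_limit: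
  assumes "n \<ge> 1" "j \<in> codes N n" "a \<in> X"
  shows "limitin mtopology (\<lambda>k. comp_maps \<phi> j n k a) (code_point j n) sequentially"
proof -
  obtain l where l: "limitin mtopology (\<lambda>k. comp_maps \<phi> j n k a) l sequentially"
    using comp_maps_convergent[OF assms] by blast
  have all: "\<forall>b\<in>X. limitin mtopology (\<lambda>k. comp_maps \<phi> j n k b) l sequentially"
    using comp_maps_limit_change_points[OF assms(1,2), where x="\<lambda>_. a" and y="\<lambda>_. b" for b]
      l assms(3) by blast
  have "code_point j n = l"
    unfolding code_point_def
    using all nonempty by (intro the_equality) (auto intro: limitin_metric_unique)
  then show ?thesis
    using l by simp
qed

lemma code_point_eqI:
  assumes "n \<ge> 1" "j \<in> codes N n" "\<And>k. y k \<in> X"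
    and "limitin mtopology (\<lambda>k. comp_maps \<phi> j n k (y k)) l sequentially"
  shows "code_point j n = l"
proof -
  obtain a where "a \<in> X"
    using nonempty by blast
  then have "limitin mtopology (\<lambda>k. comp_maps \<phi> j n k a) l sequentially"
    using assms by (intro comp_maps_limit_change_points[where x=y and y="\<lambda>_. a", OF _ _ _ _ assms(4)])
  then show ?thesis
    using code_point_limit[OF assms(1,2) \<open>a \<in> X\<close>]
    by (metis limitin_metric_unique sequentially_bot)
qed

lemma code_point_in: "n \<ge> 1 \<Longrightarrow> j \<in> codes N n \<Longrightarrow> code_point j n \<in> X"
  using code_point_limit limitin_mspace nonempty by blast

lemma code_point_cong:
  "(\<And>m. m \<ge> n \<Longrightarrow> i m = j m) \<Longrightarrow> code_point i n = code_point j n"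
  unfolding code_point_def by (simp add: comp_maps_cong[of n i j])

lemma limit_set_eq:
  assumes "n \<ge> 1" "a \<in> X"
  shows "limit_set X \<rho> N \<phi> a n = (\<lambda>j. code_point j n) ` codes N n"
  unfolding limit_set_def
proof (intro equalityI subsetI)
  fix l assume "l \<in> {l. \<exists>j\<in>codes N n. limitin mtopology (\<lambda>k. comp_maps \<phi> j n k a) l sequentially}"
  then obtain j where "j \<in> codes N n" "limitin mtopology (\<lambda>k. comp_maps \<phi> j n k a) l sequentially"
    by blast
  moreover from this have "code_point j n = l"
    using assms by (intro code_point_eqI[where y="\<lambda>_. a"])
  ultimately show "l \<in> (\<lambda>j. code_point j n) ` codes N n"
    by blast
qed (use code_point_limit assms in blast)

lemma continuous_map_phi:
  assumes "n \<ge> 1" "j \<in> {1..N n}"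
  shows "continuous_map mtopology mtopology (\<phi> n j)"
  unfolding metric_continuous_map[OF Metric_space_axioms]
proof (intro conjI ballI allI impI)
  show "\<phi> n j ` X \<subseteq> X"
    using maps assms by auto
  fix a and e :: real assume a: "a \<in> X" and e: "e > 0"
  have cp: "c n > 0"
    using c_pos assms by auto
  have "\<rho> (\<phi> n j a) (\<phi> n j x) < e" if "x \<in> X" "\<rho> a x < e / c n" for x
    using lipschitz[OF assms a that(1)] that(2) cp
    by (simp add: pos_less_divide_eq mult.commute)
  then show "\<exists>\<delta>>0. \<forall>x. x \<in> X \<and> \<rho> a x < \<delta> \<longrightarrow> \<rho> (\<phi> n j a) (\<phi> n j x) < e"
    using cp e by (intro exI[of _ "e / c n"]) auto
qed

text \<open>The outermost map is continuous and passes through the limit defining the point at level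
  \<open>Suc n\<close>; by \<open>comp_maps_Suc_left\<close> the resulting sequence is the one of
  level n shifted by one index.\<close>

lemma code_point_unroll:
  assumes "n \<ge> 1" "j \<in> codes N n"
  shows "code_point j n = \<phi> n (j n) (code_point j (Suc n))"
proof -
  obtain a where a: "a \<in> X"
    using nonempty by blast
  have j: "j n \<in> {1..N n}" "j \<in> codes N (Suc n)"
    using assms by (auto simp: codes_def)
  have "limitin mtopology (\<phi> n (j n) \<circ> (\<lambda>k. comp_maps \<phi> j (Suc n) k a))
          (\<phi> n (j n) (code_point j (Suc n))) sequentially"
    using a j assms by (intro continuous_map_limit[OF continuous_map_phi] code_point_limit) auto
  moreover have "\<phi> n (j n) \<circ> (\<lambda>k. comp_maps \<phi> j (Suc n) k a) = (\<lambda>k. comp_maps \<phi> j n (Suc k) a)"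
    by (auto simp: comp_maps_Suc_left simp del: comp_maps.simps)
  ultimately have "limitin mtopology (\<lambda>k. comp_maps \<phi> j n (k + 1) a)
          (\<phi> n (j n) (code_point j (Suc n))) sequentially"
    by (simp del: comp_maps.simps)
  then have "limitin mtopology (\<lambda>k. comp_maps \<phi> j n k a)
          (\<phi> n (j n) (code_point j (Suc n))) sequentially"
    by (rule limitin_sequentially_offset_rev)
  then show ?thesis
    using assms a by (intro code_point_eqI[where y="\<lambda>_. a"])
qed

text \<open>Exhibits the code point as a value of the k-th composition itself, so that the uniform
  estimate also bounds its distance to the approximations.\<close>

lemma code_point_unroll_comp:
  assumes "n \<ge> 1" "j \<in> codes N n"
  shows "code_point j n = comp_maps \<phi> j n k (code_point j (n + Suc k))"
proof (induction k)
  case 0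
  then show ?case
    using code_point_unroll[OF assms] by simp
next
  case (Suc k)
  then show ?case
    using code_point_unroll[of "n + Suc k" j] assms codes_mono[of j N n "n + Suc k"] by simp
qed

section \<open>The limit sets as the unique invariant compact sets\<close>

lemma limit_set_invariant:
  assumes "n \<ge> 1" "a \<in> X"
  shows "limit_set X \<rho> N \<phi> a n = (\<Union>j\<in>{1..N n}. \<phi> n j ` limit_set X \<rho> N \<phi> a (n + 1))"
proof -
  have eq: "limit_set X \<rho> N \<phi> a n = (\<lambda>j. code_point j n) ` codes N n"
    "limit_set X \<rho> N \<phi> a (n + 1) = (\<lambda>j. code_point j (Suc n)) ` codes N (Suc n)"
    using assms by (auto simp: limit_set_eq)
  have "code_point j n \<in> (\<Union>i\<in>{1..N n}. \<phi> n i ` (\<lambda>j. code_point j (Suc n)) ` codes N (Suc n))"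
    if "j \<in> codes N n" for j
  proof -
    have "j n \<in> {1..N n}" "j \<in> codes N (Suc n)"
      using that by (auto simp: codes_def)
    then show ?thesis
      using code_point_unroll[OF assms(1) that] by blast
  qed
  \<comment> \<open>Overwriting digit n by i leaves the later digits, and hence the point at level
    \<open>Suc n\<close>, unchanged.\<close>
  moreover have "\<phi> n i (code_point j (Suc n)) \<in> (\<lambda>j. code_point j n) ` codes N n"
    if "i \<in> {1..N n}" "j \<in> codes N (Suc n)" for i j
  proof -
    have j': "j(n := i) \<in> codes N n"
      using that by (auto simp: codes_def)
    have "code_point (j(n := i)) n = \<phi> n i (code_point (j(n := i)) (Suc n))"
      using code_point_unroll[OF assms(1) j'] by simp
    also have "code_point (j(n := i)) (Suc n) = code_point j (Suc n)"
      by (rule code_point_cong) auto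
    finally show ?thesis
      using j' by (metis image_eqI)
  qed
  ultimately show ?thesis
    unfolding eq by blast
qed

lemma limit_set_nonempty:
  assumes "n \<ge> 1" "a \<in> X"
  shows "limit_set X \<rho> N \<phi> a n \<noteq> {}"
proof -
  have "(\<lambda>_. 1) \<in> codes N n"
    using N_pos assms by (auto simp: codes_def)
  then show ?thesis
    using limit_set_eq[OF assms] by auto
qed

text \<open>Unrolling the inclusion hypothesis at a point of \<open>L n\<close> reads off a code of that point.\<close>

lemma subset_limit_set:
  assumes n: "n \<ge> 1" and a: "a \<in> X"
    and L: "\<And>m. m \<ge> n \<Longrightarrow> L m \<subseteq> X"
    and step: "\<And>m. m \<ge> n \<Longrightarrow> L m \<subseteq> (\<Union>j\<in>{1..N m}. \<phi> m j ` L (Suc m))"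
  shows "L n \<subseteq> limit_set X \<rho> N \<phi> a n"
proof
  fix x assume x: "x \<in> L n"
  \<comment> \<open>Dependent choice yields some first element; the clause for \<open>k = 0\<close>
    forces it to be x.\<close>
  have "\<exists>f. \<forall>k. (f k \<in> L (n + k) \<and> (k = 0 \<longrightarrow> f k = x)) \<and>
              (\<exists>i\<in>{1..N (n + k)}. f k = \<phi> (n + k) i (f (Suc k)))"
  proof (rule dependent_nat_choice)
    fix y k
    assume "y \<in> L (n + k) \<and> (k = 0 \<longrightarrow> y = x)"
    then show "\<exists>z. (z \<in> L (n + Suc k) \<and> (Suc k = 0 \<longrightarrow> z = x)) \<and>
                 (\<exists>i\<in>{1..N (n + k)}. y = \<phi> (n + k) i z)"
      using step[of "n + k"] by fastforce
  qed (use x in auto)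
  then obtain f where f: "\<And>k. f k \<in> L (n + k)" "f 0 = x"
    and "\<forall>k. \<exists>i. i \<in> {1..N (n + k)} \<and> f k = \<phi> (n + k) i (f (Suc k))"
    by blast
  then obtain i where i: "\<And>k. i k \<in> {1..N (n + k)}" "\<And>k. f k = \<phi> (n + k) (i k) (f (Suc k))"
    by metis
  \<comment> \<open>The choices are counted from 0, the digits of a code by their level. Below n
    truncated subtraction gives \<open>i 0\<close>, a value that \<open>codes N n\<close> does not
    constrain.\<close>
  define j where "j m = i (m - n)" for m
  have j: "j \<in> codes N n"
  proof -
    have "j m \<in> {1..N m}" if "m \<ge> n" for m
      using i(1)[of "m - n"] that by (simp add: j_def)
    then show ?thesis
      by (simp add: codes_def)
  qed
  \<comment> \<open>Along the moving base points \<open>f (Suc k)\<close> the compositions are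
    constantly x, so x is the point of the code j.\<close>
  have "comp_maps \<phi> j n k (f (Suc k)) = x" for k
  proof (induction k)
    case 0
    then show ?case
      using i(2)[of 0] f(2) by (simp add: j_def)
  next
    case (Suc k)
    then show ?case
      using i(2)[of "Suc k"] by (simp add: j_def)
  qed
  moreover have fX: "f (Suc k) \<in> X" for k
    using f(1)[of "Suc k"] L[of "n + Suc k"] by auto
  ultimately have "limitin mtopology (\<lambda>k. comp_maps \<phi> j n k (f (Suc k))) x sequentially"
    using L[of n] x by (auto simp: limitin_const)
  then have "code_point j n = x"
    using n j fX by (intro code_point_eqI[where y="\<lambda>k. f (Suc k)"])
  then show "x \<in> limit_set X \<rho> N \<phi> a n"
    using limit_set_eq[OF n a] j by auto
qed

lemma limit_set_subset: "n \<ge> 1 \<Longrightarrow> a \<in> X \<Longrightarrow> limit_set X \<rho> N \<phi> a n \<subseteq> X"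
  using code_point_in by (auto simp: limit_set_eq)

text \<open>The closures of the limit sets again satisfy the inclusion of \<open>subset_limit_set\<close>,
  because a finite union of continuous images of compact sets is closed.\<close>

lemma limit_set_compact:
  assumes n: "n \<ge> 1" and a: "a \<in> X"
  shows "compactin mtopology (limit_set X \<rho> N \<phi> a n)"
proof -
  define F where "F m = mtopology closure_of (limit_set X \<rho> N \<phi> a m)" for m
  have cpt: "compactin mtopology (F m)" for m
    unfolding F_def by (intro closedin_compact_space compact closedin_closure_of)
  have F_sup: "limit_set X \<rho> N \<phi> a m \<subseteq> F m" if "m \<ge> 1" for m
    unfolding F_def using limit_set_subset[OF that a] by (intro closure_of_subset) auto
  have "F m \<subseteq> (\<Union>j\<in>{1..N m}. \<phi> m j ` F (Suc m))" if m: "m \<ge> 1" for m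
  proof -
    have "compactin mtopology (\<Union>j\<in>{1..N m}. \<phi> m j ` F (Suc m))"
      using image_compactin[OF cpt continuous_map_phi] m by (intro compactin_Union) auto
    then have "closedin mtopology (\<Union>j\<in>{1..N m}. \<phi> m j ` F (Suc m))"
      by (intro compactin_imp_closedin Hausdorff_space_mtopology)
    moreover have "limit_set X \<rho> N \<phi> a m \<subseteq> (\<Union>j\<in>{1..N m}. \<phi> m j ` F (Suc m))"
      using F_sup[of "Suc m"] unfolding limit_set_invariant[OF m a]
      by (intro UN_mono image_mono) auto
    ultimately show ?thesis
      unfolding F_def[of m] by (intro closure_of_minimal)
  qed
  moreover have "F m \<subseteq> X" for m
    unfolding F_def using closure_of_subset_topspace[of mtopology] by simp
  ultimately have "F n \<subseteq> limit_set X \<rho> N \<phi> a n"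
    using n a by (intro subset_limit_set) auto
  then show ?thesis
    using F_sup[OF n] cpt[of n] by simp
qed

text \<open>If the k-th composition starts from a point of the matching later set of L, its value
  lies in \<open>L n\<close>. The limit is the code point whatever the base points are, and it stays
  in the closed set \<open>L n\<close>.\<close>

lemma limit_set_subset_invariant_set:
  assumes n: "n \<ge> 1" and a: "a \<in> X" and L: "invariant_sets X \<rho> N \<phi> L"
  shows "limit_set X \<rho> N \<phi> a n \<subseteq> L n"
proof -
  have L_closed: "closedin mtopology (L m)" and L_ne: "L m \<noteq> {}"
    and L_eq: "L m = (\<Union>j\<in>{1..N m}. \<phi> m j ` L (Suc m))" if "m \<ge> 1" for m
    using L that compactin_imp_closedin[OF Hausdorff_space_mtopology]
    unfolding invariant_sets_def Suc_eq_plus1 by blast+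
  have L_sub: "L m \<subseteq> X" if "m \<ge> 1" for m
    using closedin_subset[OF L_closed[OF that]] by simp
  have "code_point j n \<in> L n" if j: "j \<in> codes N n" for j
  proof -
    \<comment> \<open>The composition with index k has k+1 factors, the last one at level n+k, so
      its argument belongs to level \<open>n + Suc k\<close>.\<close>
    define y where "y k = (SOME y. y \<in> L (n + Suc k))" for k
    have y: "y k \<in> L (n + Suc k)" for k
      unfolding y_def using L_ne[of "n + Suc k"] by (auto intro: someI)
    then have yX: "y k \<in> X" for k
      using L_sub[of "n + Suc k"] by auto
    have "comp_maps \<phi> j n k z \<in> L n" if "z \<in> L (n + Suc k)" for k z
      using that
    proof (induction k arbitrary: z)
      case 0
      then show ?case
        using j n L_eq[OF n] by (auto simp: codes_def)
    next
      case (Suc k)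
      have "\<phi> (n + Suc k) (j (n + Suc k)) z \<in> L (n + Suc k)"
        using Suc.prems j n by (subst L_eq) (auto simp: codes_def)
      then show ?case
        using Suc.IH by simp
    qed
    then have "\<forall>\<^sub>F k in sequentially. comp_maps \<phi> j n k (y k) \<in> L n"
      using y by simp
    moreover have "limitin mtopology (\<lambda>k. comp_maps \<phi> j n k (y k)) (code_point j n) sequentially"
      using comp_maps_limit_change_points[OF n j a yX code_point_limit[OF n j a]] .
    ultimately show ?thesis
      by (intro limitin_closedin[OF _ L_closed[OF n]]) auto
  qed
  then show ?thesis
    using limit_set_eq[OF n a] by auto
qed

theorem invariant_sets_limit_set: "a \<in> X \<Longrightarrow> invariant_sets X \<rho> N \<phi> (limit_set X \<rho> N \<phi> a)"
  unfolding invariant_sets_def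
  by (intro allI impI conjI limit_set_nonempty limit_set_compact limit_set_invariant)

theorem invariant_sets_unique:
  assumes "n \<ge> 1" "a \<in> X" "invariant_sets X \<rho> N \<phi> L"
  shows "L n = limit_set X \<rho> N \<phi> a n"
proof
  show "limit_set X \<rho> N \<phi> a n \<subseteq> L n"
    using assms by (rule limit_set_subset_invariant_set)
  have L: "L m \<subseteq> X" "L m = (\<Union>j\<in>{1..N m}. \<phi> m j ` L (Suc m))" if "m \<ge> 1" for m
    using assms(3) that compactin_subset_topspace[of mtopology "L m"]
    unfolding invariant_sets_def Suc_eq_plus1 topspace_mtopology by blast+
  show "L n \<subseteq> limit_set X \<rho> N \<phi> a n"
  proof (rule subset_limit_set[OF assms(1,2)])
    fix m assume "m \<ge> n"
    then have m: "m \<ge> 1"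
      using assms(1) by simp
    show "L m \<subseteq> X" "L m \<subseteq> (\<Union>j\<in>{1..N m}. \<phi> m j ` L (Suc m))"
      by (rule L(1)[OF m], rule equalityD1[OF L(2)[OF m]])
  qed
qed

lemma limit_set_indep: "n \<ge> 1 \<Longrightarrow> a \<in> X \<Longrightarrow> b \<in> X \<Longrightarrow> limit_set X \<rho> N \<phi> a n = limit_set X \<rho> N \<phi> b n"
  by (simp add: limit_set_eq)

section \<open>Borel sets and measurability of the maps\<close>

abbreviation "B \<equiv> metric_borel X \<rho>"

lemmas sets_B = sets_metric_borel(1)[OF Metric_space_axioms]
lemmas space_B [simp] = sets_metric_borel(2)[OF Metric_space_axioms]

lemma openin_sets_B: "openin mtopology U \<Longrightarrow> U \<in> sets B"
  by (auto simp: sets_B)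

lemma closedin_sets_B: "closedin mtopology C \<Longrightarrow> C \<in> sets B"
  using sets.compl_sets[OF openin_sets_B, of "X - C"] closedin_subset[of mtopology C]
  by (auto simp: closedin_def double_diff)

lemma measurable_into_B:
  assumes "f \<in> space M \<rightarrow> X" "\<And>U. openin mtopology U \<Longrightarrow> f -` U \<inter> space M \<in> sets M"
  shows "f \<in> measurable M B"
  unfolding metric_borel_def
  using assms openin_subset[of mtopology] by (intro measurable_measure_of) auto

lemma measurable_phi:
  assumes "n \<ge> 1" "j \<in> {1..N n}" "sets M = sets B"
  shows "\<phi> n j \<in> measurable M B"
proof (rule measurable_into_B)
  have sp: "space M = X"
    using sets_eq_imp_space_eq[OF assms(3)] by simp
  show "\<phi> n j \<in> space M \<rightarrow> X"
    using maps assms sp by auto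
  fix U assume "openin mtopology U"
  then have "openin mtopology {x \<in> topspace mtopology. \<phi> n j x \<in> U}"
    using continuous_map_phi[OF assms(1,2)] by (rule openin_continuous_map_preimage[rotated])
  moreover have "{x \<in> topspace mtopology. \<phi> n j x \<in> U} = \<phi> n j -` U \<inter> space M"
    using sp by auto
  ultimately show "\<phi> n j -` U \<inter> space M \<in> sets M"
    using openin_sets_B assms(3) by auto
qed

section \<open>Neighbourhoods and uniqueness of the invariant measures\<close>

definition nbhd :: "real \<Rightarrow> 'a set \<Rightarrow> 'a set" where
  "nbhd r A = (\<Union>x\<in>A. mball x r)"

lemma nbhd_sets_B: "nbhd r A \<in> sets B"
  unfolding nbhd_def by (intro openin_sets_B openin_Union) auto

lemma nbhd_mono: "r \<le> s \<Longrightarrow> nbhd r A \<subseteq> nbhd s A"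
  unfolding nbhd_def by (intro UN_mono mball_subset_concentric) auto

text \<open>A point outside C has a ball of some radius e disjoint from C, so it drops out once
  \<open>r k < e\<close>.\<close>

lemma INT_nbhd_closed:
  assumes C: "closedin mtopology C" and r: "\<And>k. r k > 0" "r \<longlonglongrightarrow> 0"
  shows "(\<Inter>k. nbhd (r k) C) = C"
proof
  show "C \<subseteq> (\<Inter>k. nbhd (r k) C)"
    using closedin_subset[OF C] r(1) by (force simp: nbhd_def)
  show "(\<Inter>k. nbhd (r k) C) \<subseteq> C"
  proof
    fix x assume x: "x \<in> (\<Inter>k. nbhd (r k) C)"
    then have xX: "x \<in> X"
      by (auto simp: nbhd_def)
    show "x \<in> C"
    proof (rule ccontr)
      assume "x \<notin> C"
      then obtain e where e: "e > 0" "disjnt C (mball x e)"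
        using C xX unfolding closedin_metric by blast
      obtain k where "r k < e"
        using order_tendstoD(2)[OF r(2) e(1)] eventually_sequentially by auto
      moreover obtain y where "y \<in> C" "x \<in> mball y (r k)"
        using x by (auto simp: nbhd_def)
      ultimately show False
        using e(2) commute[of x y] by (auto simp: disjnt_iff)
    qed
  qed
qed

text \<open>A Levy-Prokhorov type comparison: \<open>\<nu> n\<close> and \<open>\<mu> n\<close> are closer than \<open>\<nu> (n + k)\<close> and
  \<open>\<mu> (n + k)\<close> by the contraction factor of \<open>k\<close> levels, and the latter distance is at most
  the diameter of \<open>X\<close>.\<close>

lemma invariant_measures_nbhd:
  assumes R: "\<And>x y. x \<in> X \<Longrightarrow> y \<in> X \<Longrightarrow> \<rho> x y < R"
    and \<mu>: "invariant_measures X \<rho> N \<phi> p K \<mu>" and \<nu>: "invariant_measures X \<rho> N \<phi> p K' \<nu>"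
  shows "n \<ge> 1 \<Longrightarrow> A \<in> sets B \<Longrightarrow>
     emeasure (\<nu> n) A \<le> emeasure (\<mu> n) (nbhd ((\<Prod>i\<in>{n..<n+k}. c i) * R) A)"
proof (induction k arbitrary: n A)
  case 0
  interpret \<nu>: prob_space "\<nu> n"
    using \<nu> 0 by (auto simp: invariant_measures_def)
  interpret \<mu>: prob_space "\<mu> n"
    using \<mu> 0 by (auto simp: invariant_measures_def)
  show ?case
  proof (cases "A = {}")
    case False
    have "A \<subseteq> X"
      using sets.sets_into_space[OF 0(2)] by simp
    \<comment> \<open>All distances in X are below R, so the neighbourhood of a nonempty set carries
      the whole mass 1.\<close>
    then have "nbhd R A = X"
      using False R by (fastforce simp: nbhd_def)
    moreover have "space (\<mu> n) = X"
      using \<mu> 0 by (auto simp: invariant_measures_def)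
    ultimately show ?thesis
      using \<mu>.emeasure_space_1 \<nu>.emeasure_le_1 by simp
  qed simp
next
  case (Suc k)
  define s where "s = (\<Prod>i\<in>{Suc n..<Suc n+k}. c i) * R"
  \<comment> \<open>Splitting off \<open>c n\<close> leaves the radius s that the induction
    hypothesis provides at level \<open>Suc n\<close>.\<close>
  have prod: "(\<Prod>i\<in>{n..<n+Suc k}. c i) * R = c n * s"
    by (simp add: s_def prod.atLeast_Suc_lessThan)
  have AX: "A \<subseteq> X"
    using sets.sets_into_space[OF Suc.prems(2)] by simp
  have inv: "emeasure (\<kappa> n) E =
      (\<Sum>j=1..N n. ennreal (p n j) * emeasure (\<kappa> (Suc n)) (\<phi> n j -` E \<inter> X))"
    if "invariant_measures X \<rho> N \<phi> p H \<kappa>" "E \<in> sets B" for \<kappa> H E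
  proof -
    have k: "sets (\<kappa> (Suc n)) = sets B" "space (\<kappa> (Suc n)) = X"
      using that by (auto simp: invariant_measures_def)
    have "emeasure (\<kappa> n) E = (\<Sum>j=1..N n. ennreal (p n j) * emeasure (distr (\<kappa> (n+1)) B (\<phi> n j)) E)"
      using that Suc.prems(1) unfolding invariant_measures_def by blast
    also have "\<dots> = (\<Sum>j=1..N n. ennreal (p n j) * emeasure (\<kappa> (Suc n)) (\<phi> n j -` E \<inter> X))"
      using that(2) k measurable_phi[OF Suc.prems(1) _ k(1)]
      by (intro sum.cong refl) (simp add: emeasure_distr)
    finally show ?thesis .
  qed
  have "emeasure (\<nu> n) A =
      (\<Sum>j=1..N n. ennreal (p n j) * emeasure (\<nu> (Suc n)) (\<phi> n j -` A \<inter> X))"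
    using \<nu> Suc.prems by (intro inv)
  also have "\<dots> \<le>
      (\<Sum>j=1..N n. ennreal (p n j) * emeasure (\<mu> (Suc n)) (\<phi> n j -` nbhd (c n * s) A \<inter> X))"
  proof (intro sum_mono mult_left_mono)
    fix j assume j: "j \<in> {1..N n}"
    have meas: "\<phi> n j -` E \<inter> X \<in> sets B" if "E \<in> sets B" for E
      using measurable_sets[OF measurable_phi[OF Suc.prems(1) j refl] that] by simp
    have \<mu>s: "sets (\<mu> (Suc n)) = sets B"
      using \<mu> by (auto simp: invariant_measures_def)
    \<comment> \<open>Here the contraction enters: \<open>\<phi> n j\<close> sends points at
      distance below s to points at distance below \<open>c n * s\<close>.\<close>
    have "nbhd s (\<phi> n j -` A \<inter> X) \<subseteq> \<phi> n j -` nbhd (c n * s) A \<inter> X"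
    proof
      fix y assume "y \<in> nbhd s (\<phi> n j -` A \<inter> X)"
      then obtain x where x: "x \<in> X" "\<phi> n j x \<in> A" "y \<in> X" "\<rho> x y < s"
        by (auto simp: nbhd_def)
      have "\<rho> (\<phi> n j x) (\<phi> n j y) \<le> c n * \<rho> x y"
        using lipschitz Suc.prems(1) j x by blast
      also have "\<dots> < c n * s"
        using c_pos[OF Suc.prems(1)] x(4) by simp
      finally show "y \<in> \<phi> n j -` nbhd (c n * s) A \<inter> X"
        using x maps[OF Suc.prems(1) j] by (auto simp: nbhd_def)
    qed
    then have "emeasure (\<mu> (Suc n)) (nbhd s (\<phi> n j -` A \<inter> X))
        \<le> emeasure (\<mu> (Suc n)) (\<phi> n j -` nbhd (c n * s) A \<inter> X)"
      using meas[OF nbhd_sets_B] \<mu>s by (intro emeasure_mono) auto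
    moreover have "emeasure (\<nu> (Suc n)) (\<phi> n j -` A \<inter> X)
        \<le> emeasure (\<mu> (Suc n)) (nbhd s (\<phi> n j -` A \<inter> X))"
      unfolding s_def using meas[OF Suc.prems(2)] by (intro Suc.IH) auto
    ultimately show "emeasure (\<nu> (Suc n)) (\<phi> n j -` A \<inter> X)
        \<le> emeasure (\<mu> (Suc n)) (\<phi> n j -` nbhd (c n * s) A \<inter> X)"
      by (rule order.trans[rotated])
  qed auto
  also have "\<dots> = emeasure (\<mu> n) (nbhd (c n * s) A)"
    using \<mu> nbhd_sets_B by (intro inv[symmetric])
  finally show ?case
    unfolding prod .
qed

lemma invariant_measures_le_closed:
  assumes \<mu>: "invariant_measures X \<rho> N \<phi> p K \<mu>" and \<nu>: "invariant_measures X \<rho> N \<phi> p K' \<nu>"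
    and n: "n \<ge> 1" and C: "closedin mtopology C"
  shows "emeasure (\<nu> n) C \<le> emeasure (\<mu> n) C"
proof -
  obtain R where R: "R > 0" "\<And>x y. x \<in> X \<Longrightarrow> y \<in> X \<Longrightarrow> \<rho> x y < R"
    using bounded_dist by blast
  interpret \<mu>: prob_space "\<mu> n"
    using \<mu> n by (auto simp: invariant_measures_def)
  have s\<mu>: "sets (\<mu> n) = sets B"
    using \<mu> n by (auto simp: invariant_measures_def)
  \<comment> \<open>The locale does not make the tail products monotone in k. They are dominated by
    \<open>1 / Suc m\<close>, whose neighbourhoods decrease, so that continuity from above of the
    finite measure applies.\<close>
  have le: "emeasure (\<nu> n) C \<le> emeasure (\<mu> n) (nbhd (1 / Suc m) C)" for m
  proof -
    have "(\<lambda>k. (\<Prod>i\<in>{n..<n+k}. c i) * R) \<longlonglongrightarrow> 0"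
      by (intro tendsto_mult_left_zero tail_prod_tendsto_0 n)
    then have "\<forall>\<^sub>F k in sequentially. (\<Prod>i\<in>{n..<n+k}. c i) * R < 1 / Suc m"
      by (rule order_tendstoD) simp
    then obtain k where k: "(\<Prod>i\<in>{n..<n+k}. c i) * R < 1 / Suc m"
      using eventually_happens'[OF sequentially_bot] by blast
    have "emeasure (\<nu> n) C \<le> emeasure (\<mu> n) (nbhd ((\<Prod>i\<in>{n..<n+k}. c i) * R) C)"
      using n closedin_sets_B[OF C] by (intro invariant_measures_nbhd[OF _ \<mu> \<nu>] R(2))
    also have "\<dots> \<le> emeasure (\<mu> n) (nbhd (1 / Suc m) C)"
      using k nbhd_sets_B s\<mu> by (intro emeasure_mono nbhd_mono) auto
    finally show ?thesis .
  qed
  have "emeasure (\<nu> n) C \<le> (INF m. emeasure (\<mu> n) (nbhd (1 / Suc m) C))"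
    by (intro INF_greatest le)
  also have "(INF m. emeasure (\<mu> n) (nbhd (1 / Suc m) C)) = emeasure (\<mu> n) (\<Inter>m. nbhd (1 / Suc m) C)"
    using nbhd_sets_B s\<mu> by (intro INF_emeasure_decseq decseq_SucI nbhd_mono) (auto simp: field_simps)
  also have "(\<Inter>m. nbhd (1 / Suc m) C) = C"
    using LIMSEQ_inverse_real_of_nat by (intro INT_nbhd_closed C) (auto simp: inverse_eq_divide)
  finally show ?thesis .
qed

text \<open>The comparison on closed sets holds in both directions, and the closed sets form an
  intersection-stable generator of the Borel sets.\<close>

theorem invariant_measures_unique:
  assumes \<mu>: "invariant_measures X \<rho> N \<phi> p K \<mu>" and \<nu>: "invariant_measures X \<rho> N \<phi> p K' \<nu>"
    and n: "n \<ge> 1"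
  shows "\<nu> n = \<mu> n"
proof (rule measure_eqI_generator_eq[where E="{C. closedin mtopology C}" and \<Omega>=X and A="\<lambda>_. X"])
  show "Int_stable {C. closedin mtopology C}"
    by (auto simp: Int_stable_def)
  show "{C. closedin mtopology C} \<subseteq> Pow X"
    using closedin_subset[of mtopology] by auto
  show "emeasure (\<nu> n) C = emeasure (\<mu> n) C" if "C \<in> {C. closedin mtopology C}" for C
    using that invariant_measures_le_closed[OF \<mu> \<nu> n] invariant_measures_le_closed[OF \<nu> \<mu> n]
    by (intro antisym) auto
  have "sigma_sets X {U. openin mtopology U} = sigma_sets X {C. closedin mtopology C}"
  proof (intro equalityI sigma_sets_mono subsetI)
    fix U assume "U \<in> {U. openin mtopology U}"
    then have "X - U \<in> {C. closedin mtopology C}" and "X - (X - U) = U"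
      using openin_subset[of mtopology U] by auto
    then show "U \<in> sigma_sets X {C. closedin mtopology C}"
      by (metis sigma_sets.Basic sigma_sets.Compl)
  next
    fix C assume "C \<in> {C. closedin mtopology C}"
    then show "C \<in> sigma_sets X {U. openin mtopology U}"
      using closedin_sets_B sets_B by auto
  qed
  then show "sets (\<nu> n) = sigma_sets X {C. closedin mtopology C}"
    and "sets (\<mu> n) = sigma_sets X {C. closedin mtopology C}"
    using \<mu> \<nu> n sets_B by (auto simp: invariant_measures_def)
  show "emeasure (\<nu> n) X \<noteq> \<infinity>" for i :: nat
  proof -
    interpret \<nu>: prob_space "\<nu> n"
      using \<nu> n by (auto simp: invariant_measures_def)
    show ?thesis
      by simp
  qed
qed auto

section \<open>Existence of the invariant measures by random coding\<close>

text \<open>Replacing the illegal digits of a sequence makes the coding map total, so that it is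
  defined on the whole product space.\<close>

definition clip :: "(nat \<Rightarrow> nat) \<Rightarrow> nat \<Rightarrow> nat" where
  "clip w m = (if w m \<in> {1..N m} then w m else 1)"

lemma clip_codes: "n \<ge> 1 \<Longrightarrow> clip w \<in> codes N n"
  using N_pos by (auto simp: codes_def clip_def)

text \<open>With mass functions as factors every coordinate carries the discrete sigma-algebra, so
  any condition on finitely many digits is an event.\<close>

abbreviation code_space :: "(nat \<Rightarrow> nat pmf) \<Rightarrow> (nat \<Rightarrow> nat) measure" where
  "code_space P \<equiv> PiM UNIV (\<lambda>m. measure_pmf (P m))"

lemma space_code_space [simp]: "space (code_space P) = UNIV"
  by (simp add: space_PiM)

lemma measurable_clip: "(\<lambda>w. clip w m) \<in> measurable (code_space P) (count_space UNIV)"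
proof -
  have "(\<lambda>w. w m) \<in> measurable (code_space P) (measure_pmf (P m))"
    by (rule measurable_component_singleton) simp
  from measurable_compose[OF this, of "\<lambda>i. if i \<in> {1..N m} then i else 1"]
  show ?thesis
    by (simp add: clip_def)
qed

text \<open>The value depends on finitely many digits from a countable set, hence Q may be
  arbitrary. The induction splits over the value of the innermost digit, which changes the argument
  x.\<close>

lemma pred_comp_maps: "Measurable.pred (code_space P) (\<lambda>w. Q (comp_maps \<phi> (clip w) n k x))"
proof (induction k arbitrary: x)
  case 0
  show ?case
    using measurable_compose[OF measurable_clip, of "\<lambda>i. Q (\<phi> n i x)"] by simp
next
  case (Suc k)
  show ?case
    using measurable_compose_countable[OF Suc.IH measurable_clip] by simp
qed

text \<open>The point lies in an open U iff one of countably many approximating balls lies in U.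
  Centre and radius of each ball are determined by finitely many digits, so the preimage of U is a
  countable union of events.\<close>

lemma measurable_code_point:
  assumes n: "n \<ge> 1"
  shows "(\<lambda>w. code_point (clip w) n) \<in> measurable (code_space P) B"
proof (rule measurable_into_B)
  show "(\<lambda>w. code_point (clip w) n) \<in> space (code_space P) \<rightarrow> X"
    using code_point_in clip_codes n by auto
  fix U assume U: "openin mtopology U"
  obtain a where a: "a \<in> X"
    using nonempty by blast
  \<comment> \<open>The depth that guarantees the error \<open>1 / Suc m\<close> is the same for all
    codes, so it can be fixed before the code is drawn.\<close>
  have "\<exists>k. \<forall>j x y. j \<in> codes N n \<longrightarrow> x \<in> X \<longrightarrow> y \<in> X \<longrightarrow>
      \<rho> (comp_maps \<phi> j n k x) (comp_maps \<phi> j n k y) < 1 / Suc m" for m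
    using comp_maps_uniformly_close[OF n, of "1 / Suc m"]
    by (metis order.refl of_nat_0_less_iff zero_less_Suc zero_less_divide_1_iff)
  then obtain k where k: "\<And>m j x y. j \<in> codes N n \<Longrightarrow> x \<in> X \<Longrightarrow> y \<in> X \<Longrightarrow>
      \<rho> (comp_maps \<phi> j n (k m) x) (comp_maps \<phi> j n (k m) y) < 1 / Suc m"
    by metis
  have iff: "code_point j n \<in> U \<longleftrightarrow> (\<exists>m. mball (comp_maps \<phi> j n (k m) a) (1 / Suc m) \<subseteq> U)"
    if j: "j \<in> codes N n" for j
  proof -
    let ?x = "\<lambda>m. comp_maps \<phi> j n (k m) a"
    have xX: "?x m \<in> X" and cX: "code_point j n \<in> X" for m
      using comp_maps_in[OF n j a] code_point_in[OF n j] by auto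
    have close: "\<rho> (?x m) (code_point j n) < 1 / Suc m" for m
    proof -
      have "code_point j (n + Suc (k m)) \<in> X"
        using n codes_mono[OF j] by (intro code_point_in) auto
      then show ?thesis
        using code_point_unroll_comp[OF n j, of "k m"] k[OF j a, of "code_point j (n + Suc (k m))" m]
        by simp
    qed
    show ?thesis
    proof
      assume "code_point j n \<in> U"
      then obtain e where e: "e > 0" "mball (code_point j n) e \<subseteq> U"
        using U unfolding openin_mtopology by blast
      obtain m where m: "1 / real (Suc m) < e / 2"
        using nat_approx_posE[of "e / 2"] e(1) by auto
      \<comment> \<open>The centre is within e/2 of the code point and the radius is below
        e/2.\<close>
      have "mball (?x m) (1 / Suc m) \<subseteq> mball (code_point j n) e"
        using m close[of m] cX by (intro mball_subset) auto
      then show "\<exists>m. mball (?x m) (1 / Suc m) \<subseteq> U"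
        using e(2) by blast
    next
      assume "\<exists>m. mball (?x m) (1 / Suc m) \<subseteq> U"
      then show "code_point j n \<in> U"
        using close xX cX by (auto simp: subset_iff)
    qed
  qed
  have "(\<lambda>w. code_point (clip w) n) -` U \<inter> space (code_space P) =
      (\<Union>m. {w \<in> space (code_space P). mball (comp_maps \<phi> (clip w) n (k m) a) (1 / Suc m) \<subseteq> U})"
    using iff clip_codes[OF n] by auto
  also have "\<dots> \<in> sets (code_space P)"
    using pred_comp_maps[where Q="\<lambda>x. mball x (1 / Suc m) \<subseteq> U" for m]
    by (intro sets.countable_UN) (auto simp: pred_def)
  finally show "(\<lambda>w. code_point (clip w) n) -` U \<inter> space (code_space P) \<in> sets (code_space P)" .
qed

definition code_law :: "(nat \<Rightarrow> nat pmf) \<Rightarrow> nat \<Rightarrow> 'a measure" where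
  "code_law P n = distr (code_space P) B (\<lambda>w. code_point (clip w) n)"

text \<open>Resampling the coordinate \<open>n\<close> independently preserves the product measure and
  replaces \<open>code_point (clip w) n\<close> by \<open>\<phi> n i (code_point (clip w) (Suc n))\<close>, where \<open>i\<close> is the
  new coordinate.\<close>

lemma emeasure_code_law:
  assumes n: "n \<ge> 1" and P: "set_pmf (P n) \<subseteq> {1..N n}" and A: "A \<in> sets B"
  shows "emeasure (code_law P n) A =
    (\<Sum>i=1..N n. ennreal (pmf (P n) i) * emeasure (distr (code_law P (Suc n)) B (\<phi> n i)) A)"
proof -
  let ?S = "code_space P" and ?\<pi> = "\<lambda>n w. code_point (clip w) n"
  interpret S: prob_space ?S
    by (intro prob_space_PiM prob_space_measure_pmf)
  define E where "E = ?\<pi> n -` A \<inter> space ?S"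
  have E: "E \<in> sets ?S"
    unfolding E_def using measurable_code_point[OF n] A by (rule measurable_sets)
  have resample: "distr (measure_pmf (P n) \<Otimes>\<^sub>M ?S) ?S (\<lambda>(i, w). w(n := i)) = ?S"
    using distr_pair_PiM_eq_PiM[of UNIV "\<lambda>m. measure_pmf (P m)" n]
    by (simp add: prob_space_measure_pmf)
  have upd: "(\<lambda>(i, w). w(n := i)) \<in> measurable (measure_pmf (P n) \<Otimes>\<^sub>M ?S) ?S"
    using measurable_fun_upd[of UNIV UNIV n snd "measure_pmf (P n) \<Otimes>\<^sub>M ?S" "\<lambda>m. measure_pmf (P m)" fst]
    by (simp add: split_beta')
  define F where "F = (\<lambda>(i, w). w(n := i)) -` E \<inter> space (measure_pmf (P n) \<Otimes>\<^sub>M ?S)"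
  have F: "F \<in> sets (measure_pmf (P n) \<Otimes>\<^sub>M ?S)"
    unfolding F_def using upd E by (rule measurable_sets)
  have slice: "emeasure ?S (Pair i -` F) = emeasure (distr (code_law P (Suc n)) B (\<phi> n i)) A"
    if i: "i \<in> {1..N n}" for i
  proof -
    \<comment> \<open>As i is a legal digit, clipping keeps it, and the digits above n do not
      change.\<close>
    have *: "?\<pi> n (w(n := i)) = \<phi> n i (?\<pi> (Suc n) w)" for w
      using code_point_unroll[OF n clip_codes[OF n], of "w(n := i)"] i
        code_point_cong[of "Suc n" "clip (w(n := i))" "clip w"]
      by (auto simp: clip_def)
    have m1: "?\<pi> (Suc n) \<in> measurable ?S B"
      by (rule measurable_code_point) simp
    have m2: "\<phi> n i \<in> measurable B B"
      using measurable_phi[OF n i] by simp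
    have "Pair i -` F = {w. \<phi> n i (?\<pi> (Suc n) w) \<in> A}"
      by (auto simp: F_def E_def space_pair_measure *)
    moreover have "distr (code_law P (Suc n)) B (\<phi> n i) = distr ?S B (\<phi> n i \<circ> ?\<pi> (Suc n))"
      unfolding code_law_def using m1 m2 by (intro distr_distr)
    ultimately show ?thesis
      using measurable_comp[OF m1 m2] A by (simp add: emeasure_distr vimage_def)
  qed
  have "emeasure (code_law P n) A = emeasure ?S E"
    unfolding code_law_def E_def using measurable_code_point[OF n] A by (rule emeasure_distr)
  also have "\<dots> = emeasure (distr (measure_pmf (P n) \<Otimes>\<^sub>M ?S) ?S (\<lambda>(i, w). w(n := i))) E"
    by (simp add: resample)
  also have "\<dots> = emeasure (measure_pmf (P n) \<Otimes>\<^sub>M ?S) F"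
    unfolding F_def using upd E by (rule emeasure_distr)
  also have "\<dots> = (\<integral>\<^sup>+i. emeasure ?S (Pair i -` F) \<partial>measure_pmf (P n))"
    using F by (rule S.emeasure_pair_measure_alt)
  \<comment> \<open>The new digit is supported on the finite set \<open>{1..N n}\<close>, so the
    integral over it is a finite sum.\<close>
  also have "\<dots> = (\<Sum>i=1..N n. emeasure ?S (Pair i -` F) * ennreal (pmf (P n) i))"
    using P by (intro nn_integral_measure_pmf_support) auto
  finally show ?thesis
    using slice by (simp add: mult.commute)
qed

theorem invariant_measures_exist:
  assumes p: "probability_weights N p" and a: "a \<in> X"
  shows "\<exists>\<mu>. invariant_measures X \<rho> N \<phi> p (limit_set X \<rho> N \<phi> a) \<mu>"
proof -
  have "\<exists>q. set_pmf q \<subseteq> {1..N n} \<and> (\<forall>i\<in>{1..N n}. pmf q i = p n i)" if n: "n \<ge> 1" for n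
  proof -
    \<comment> \<open>Extending the weights by 0 gives a mass function on all of nat, supported on
      the legal digits.\<close>
    define f where "f i = (if i \<in> {1..N n} then p n i else 0)" for i
    have pos: "p n i > 0" if "i \<in> {1..N n}" for i
      using p n that by (auto simp: probability_weights_def)
    have f0: "0 \<le> f i" for i
      using pos[of i] by (auto simp: f_def)
    have "(\<integral>\<^sup>+i. ennreal (f i) \<partial>count_space UNIV) = (\<Sum>i=1..N n. ennreal (f i))"
      by (intro nn_integral_count_space') (auto simp: f_def)
    also have "\<dots> = ennreal (\<Sum>i=1..N n. f i)"
      using f0 by simp
    also have "(\<Sum>i=1..N n. f i) = (\<Sum>i=1..N n. p n i)"
      by (intro sum.cong) (auto simp: f_def)
    also have "\<dots> = 1"
      using p n by (auto simp: probability_weights_def)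
    finally have f1: "(\<integral>\<^sup>+i. ennreal (f i) \<partial>count_space UNIV) = 1"
      unfolding ennreal_1 .
    show ?thesis
    proof (intro exI conjI ballI)
      show "set_pmf (embed_pmf f) \<subseteq> {1..N n}"
        unfolding set_embed_pmf[OF f0 f1] by (auto simp: f_def split: if_splits)
      show "pmf (embed_pmf f) i = p n i" if "i \<in> {1..N n}" for i
        unfolding pmf_embed_pmf[OF f0 f1] using that by (simp add: f_def)
    qed
  qed
  \<comment> \<open>\<open>P 0\<close> is some arbitrary mass function; points of level n >= 1
    depend only on digits from n on.\<close>
  then obtain P where P: "\<And>n. n \<ge> 1 \<Longrightarrow> set_pmf (P n) \<subseteq> {1..N n}"
    "\<And>n i. n \<ge> 1 \<Longrightarrow> i \<in> {1..N n} \<Longrightarrow> pmf (P n) i = p n i"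
    by metis
  interpret S: prob_space "code_space P"
    by (intro prob_space_PiM prob_space_measure_pmf)
  have "invariant_measures X \<rho> N \<phi> p (limit_set X \<rho> N \<phi> a) (code_law P)"
    unfolding invariant_measures_def
  proof (intro allI impI conjI ballI)
    fix n :: nat assume n: "n \<ge> 1"
    show "prob_space (code_law P n)"
      unfolding code_law_def using measurable_code_point[OF n] by (rule S.prob_space_distr)
    show "space (code_law P n) = X" "sets (code_law P n) = sets B"
      by (simp_all add: code_law_def)
    have K: "limit_set X \<rho> N \<phi> a n \<in> sets B"
      using limit_set_compact[OF n a]
      by (intro closedin_sets_B compactin_imp_closedin Hausdorff_space_mtopology)
    \<comment> \<open>Clipped sequences are codes, so every value of the coding map lies in the
      limit set and the support condition holds surely.\<close>
    have "(\<lambda>w. code_point (clip w) n) -` (X - limit_set X \<rho> N \<phi> a n) \<inter> space (code_space P) = {}"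
      using limit_set_eq[OF n a] clip_codes[OF n] by auto
    moreover have "X - limit_set X \<rho> N \<phi> a n \<in> sets B"
      using sets.compl_sets[OF K] by simp
    ultimately show "emeasure (code_law P n) (X - limit_set X \<rho> N \<phi> a n) = 0"
      unfolding code_law_def using measurable_code_point[OF n] by (simp add: emeasure_distr)
    fix A assume A: "A \<in> sets B"
    show "emeasure (code_law P n) A =
        (\<Sum>j=1..N n. ennreal (p n j) * emeasure (distr (code_law P (n + 1)) B (\<phi> n j)) A)"
      using emeasure_code_law[of n P, OF n P(1)[OF n] A] P(2)[OF n] by simp
  qed
  then show ?thesis
    by blast
qed

end

section \<open>From an MIFS to the locale, and the theorem\<close>

lemma moran_system_MIFS:
  assumes "MIFS X \<rho> N \<phi>"
  obtains c where "moran_system X \<rho> N \<phi> c"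
proof -
  have M: "X \<noteq> {}" "Metric_space UNIV \<rho>" "compact_space (Metric_space.mtopology X \<rho>)"
    "\<And>n. n \<ge> 1 \<Longrightarrow> 2 \<le> N n" "\<And>n j. n \<ge> 1 \<Longrightarrow> j \<in> {1..N n} \<Longrightarrow> \<phi> n j ` X \<subseteq> X"
    using assms by (auto simp: MIFS_def)
  obtain c1 c2 where c: "\<forall>n\<ge>1. 0 < c1 n \<and> c1 n \<le> c2 n \<and> c2 n < (1::real)"
    "(\<lambda>n. \<Prod>j=1..n. c2 j) \<longlonglongrightarrow> 0"
    "\<forall>n\<ge>1. \<forall>j\<in>{1..N n}. \<forall>x\<in>X. \<forall>y\<in>X.
       c1 n * \<rho> x y \<le> \<rho> (\<phi> n j x) (\<phi> n j y) \<and> \<rho> (\<phi> n j x) (\<phi> n j y) \<le> c2 n * \<rho> x y"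
    using assms unfolding MIFS_def by blast
  \<comment> \<open>The upper ratios serve as contraction factors, and their positivity comes from
    \<open>c1\<close>; the metric is restricted from the whole space to X.\<close>
  have "moran_system X \<rho> N \<phi> c2"
  proof (intro moran_system.intro moran_system_axioms.intro)
    show "Metric_space X \<rho>"
      using Metric_space.subspace[OF M(2)] by simp
    show "1 \<le> N n" if "1 \<le> n" for n
      using M(4)[OF that] by simp
    show "0 < c2 n" if "1 \<le> n" for n
      using c(1) that by (meson less_le_trans)
  qed (use M(1,3,5) c(2,3) in blast)+
  then show thesis
    by (rule that)
qed

theorem theorem2p1:
  fixes X :: "(real ^ 'd) set"
    and \<rho> :: "real ^ 'd \<Rightarrow> real ^ 'd \<Rightarrow> real"
    and N :: "nat \<Rightarrow> nat"
    and \<phi> :: "nat \<Rightarrow> nat \<Rightarrow> real ^ 'd \<Rightarrow> real ^ 'd"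
  assumes "MIFS X \<rho> N \<phi>"
  shows
    "(\<forall>n\<ge>1. \<forall>j\<in>codes N n. \<forall>a\<in>X.
        \<exists>!l. limitin (Metric_space.mtopology X \<rho>) (\<lambda>k. comp_maps \<phi> j n k a) l sequentially) \<and>
     (\<forall>n\<ge>1. \<forall>a\<in>X. compactin (Metric_space.mtopology X \<rho>) (limit_set X \<rho> N \<phi> a n)) \<and>
     (\<forall>n\<ge>1. \<forall>a\<in>X. \<forall>b\<in>X. limit_set X \<rho> N \<phi> a n = limit_set X \<rho> N \<phi> b n) \<and>
     (\<forall>a\<in>X. invariant_sets X \<rho> N \<phi> (limit_set X \<rho> N \<phi> a) \<and>
        (\<forall>L. invariant_sets X \<rho> N \<phi> L \<longrightarrow> (\<forall>n\<ge>1. L n = limit_set X \<rho> N \<phi> a n))) \<and>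
     (\<forall>p. probability_weights N p \<longrightarrow>
        (\<forall>a\<in>X. \<exists>\<mu>. invariant_measures X \<rho> N \<phi> p (limit_set X \<rho> N \<phi> a) \<mu> \<and>
           (\<forall>\<nu>. invariant_measures X \<rho> N \<phi> p (limit_set X \<rho> N \<phi> a) \<nu> \<longrightarrow>
                 (\<forall>n\<ge>1. \<nu> n = \<mu> n))))"
proof -
  obtain c where "moran_system X \<rho> N \<phi> c"
    using assms by (rule moran_system_MIFS)
  then interpret moran_system X \<rho> N \<phi> c .
  have limits: "\<exists>!l. limitin mtopology (\<lambda>k. comp_maps \<phi> j n k a) l sequentially"
    if "n \<ge> 1" "j \<in> codes N n" "a \<in> X" for n j a
    using code_point_limit[OF that] limitin_metric_unique sequentially_bot by metis
  show ?thesis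
  proof (intro conjI allI ballI impI limits limit_set_compact invariant_sets_limit_set)
    fix n :: nat and a b
    assume "1 \<le> n" "a \<in> X" "b \<in> X"
    then show "limit_set X \<rho> N \<phi> a n = limit_set X \<rho> N \<phi> b n"
      by (rule limit_set_indep)
  next
    fix a L and n :: nat
    assume "a \<in> X" "invariant_sets X \<rho> N \<phi> L" "1 \<le> n"
    then show "L n = limit_set X \<rho> N \<phi> a n"
      by (intro invariant_sets_unique)
  next
    fix p a
    assume "probability_weights N p" "a \<in> X"
    then obtain \<mu> where "invariant_measures X \<rho> N \<phi> p (limit_set X \<rho> N \<phi> a) \<mu>"
      using invariant_measures_exist by blast
    then show "\<exists>\<mu>. invariant_measures X \<rho> N \<phi> p (limit_set X \<rho> N \<phi> a) \<mu> \<and>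
        (\<forall>\<nu>. invariant_measures X \<rho> N \<phi> p (limit_set X \<rho> N \<phi> a) \<nu> \<longrightarrow> (\<forall>n\<ge>1. \<nu> n = \<mu> n))"
      using invariant_measures_unique by blast
  qed
qed

end
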